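(* Let $A$ and $B$ be C$^*$-algebras. (1) Every bounded linear 2-local homomorphism $T: A\to B$ is a homomorphism. (2) Every linear 2-local $^*$-homomorphism $T: A\to B$ is a $^*$-homomorphism.
   Context: C$^*$-algebras are complex and not assumed to be unital. A homomorphism $A\to B$ is a linear multiplicative map; a $^*$-homomorphism is a homomorphism $\Phi$ with $\Phi(a^* )=\Phi(a)^*$ for all $a$. A mapping $T:A\to B$ between C$^*$-algebras is a 2-local homomorphism (respectively, a 2-local $^*$-homomorphism) if for every $a,b\in A$ there exists a bounded homomorphism (respectively, a $^*$-homomorphism) $\Phi_{a,b}: A\to B$, depending on $a$ and $b$, such that $\Phi_{a,b}(a)=T(a)$ and $\Phi_{a,b}(b)=T(b)$. *)

theory Defs
  imports Complex_Main
begin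

class scaleC =
  fixes scaleC :: "complex \<Rightarrow> 'a \<Rightarrow> 'a"  (infixr \<open>*\<^sub>C\<close> 75)

class complex_vector = real_vector + scaleC +
  assumes scaleC_add_right: "c *\<^sub>C (x + y) = c *\<^sub>C x + c *\<^sub>C y"
    and scaleC_add_left: "(c + d) *\<^sub>C x = c *\<^sub>C x + d *\<^sub>C x"
    and scaleC_scaleC: "c *\<^sub>C d *\<^sub>C x = (c * d) *\<^sub>C x"
    and scaleC_one: "1 *\<^sub>C x = x"
    and scaleC_of_real: "complex_of_real r *\<^sub>C x = r *\<^sub>R x"

class complex_normed_vector = complex_vector + real_normed_vector +
  assumes norm_scaleC: "norm (c *\<^sub>C x) = cmod c * norm x"

text \<open>The library class \<^class>\<open>real_normed_algebra\<close> requires neither a unit nor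
  commutativity; it provides submultiplicativity of the norm.\<close>

class complex_normed_algebra = complex_normed_vector + real_normed_algebra +
  assumes scaleC_mult_left: "(c *\<^sub>C x) * y = c *\<^sub>C (x * y)"
    and scaleC_mult_right: "x * (c *\<^sub>C y) = c *\<^sub>C (x * y)"

class cstar_algebra = complex_normed_algebra + banach +
  fixes star :: "'a \<Rightarrow> 'a"
  assumes star_add: "star (x + y) = star x + star y"
    and star_scaleC: "star (c *\<^sub>C x) = cnj c *\<^sub>C star x"
    and star_mult: "star (x * y) = star y * star x"
    and star_star: "star (star x) = x"
    and cstar_identity: "norm (star x * x) = (norm x)\<^sup>2"

instantiation complex :: cstar_algebra
begin

definition scaleC_complex :: "complex \<Rightarrow> complex \<Rightarrow> complex"
  where "scaleC_complex c x = c * x"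

definition star_complex :: "complex \<Rightarrow> complex"
  where "star_complex x = cnj x"

instance
  by standard
    (simp_all add: scaleC_complex_def star_complex_def algebra_simps scaleR_conv_of_real
      norm_mult power2_eq_square)

end

interpretation complex_vector: vector_space "scaleC :: complex \<Rightarrow> 'a \<Rightarrow> 'a::complex_vector"
  by standard (simp_all add: scaleC_add_right scaleC_add_left scaleC_scaleC scaleC_one)

definition clinear :: "('a::complex_vector \<Rightarrow> 'b::complex_vector) \<Rightarrow> bool"
  where "clinear f \<longleftrightarrow> Vector_Spaces.linear scaleC scaleC f"

lemma clinear_iff:
  "clinear f \<longleftrightarrow> (\<forall>x y. f (x + y) = f x + f y) \<and> (\<forall>c x. f (c *\<^sub>C x) = c *\<^sub>C f x)"
  by (simp add: clinear_def Vector_Spaces.linear_iff complex_vector.vector_space_axioms)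

definition bounded_clinear :: "('a::complex_normed_vector \<Rightarrow> 'b::complex_normed_vector) \<Rightarrow> bool"
  where "bounded_clinear f \<longleftrightarrow> clinear f \<and> (\<exists>K. \<forall>x. norm (f x) \<le> K * norm x)"

definition algebra_hom :: "('a::cstar_algebra \<Rightarrow> 'b::cstar_algebra) \<Rightarrow> bool"
  where "algebra_hom \<Phi> \<longleftrightarrow> clinear \<Phi> \<and> (\<forall>x y. \<Phi> (x * y) = \<Phi> x * \<Phi> y)"

definition star_hom :: "('a::cstar_algebra \<Rightarrow> 'b::cstar_algebra) \<Rightarrow> bool"
  where "star_hom \<Phi> \<longleftrightarrow> algebra_hom \<Phi> \<and> (\<forall>x. \<Phi> (star x) = star (\<Phi> x))"

definition two_local_hom :: "('a::cstar_algebra \<Rightarrow> 'b::cstar_algebra) \<Rightarrow> bool"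
  where "two_local_hom T \<longleftrightarrow>
    (\<forall>a b. \<exists>\<Phi>. algebra_hom \<Phi> \<and> bounded_clinear \<Phi> \<and> \<Phi> a = T a \<and> \<Phi> b = T b)"

definition two_local_star_hom :: "('a::cstar_algebra \<Rightarrow> 'b::cstar_algebra) \<Rightarrow> bool"
  where "two_local_star_hom T \<longleftrightarrow>
    (\<forall>a b. \<exists>\<Phi>. star_hom \<Phi> \<and> \<Phi> a = T a \<and> \<Phi> b = T b)"

end

theory Submission
  imports Defs "HOL-Computational_Algebra.Formal_Power_Series"
begin

text \<open>
  For *-homomorphisms the statement is pure algebra. A linear 2-local *-homomorphism \<open>T\<close> commutes with
  the involution, so a *-homomorphism that agrees with \<open>T\<close> at \<open>x + \<i> y\<close>, with \<open>x\<close> and \<open>y\<close>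
  selfadjoint, agrees with \<open>T\<close> at \<open>x\<close> and at \<open>y\<close>. Choosing it to agree at \<open>x * y\<close> as well gives
  \<open>T (x * y) = T x * T y\<close>.

  A homomorphism that is not compatible with involutions gives less: \<open>T\<close> preserves squares, so it is a
  Jordan homomorphism, and \<open>x * y = 0\<close> implies \<open>T x * T y = 0\<close>. Such a bounded \<open>T\<close> is multiplicative
  because a C*-algebra has many zero products. Precisely, a bounded bilinear form \<open>\<phi>\<close> that vanishes on
  zero products satisfies \<open>\<phi> (b * a) c = \<phi> b (a * c)\<close> (\<open>zero_product_form_balanced\<close>). Applied to
  \<open>\<phi> x y = T x * T y\<close> this gives \<open>T (b * a) * T c = T b * T (a * c)\<close>. Together with the Jordan identity
  it yields \<open>T (x * d^2) = T x * T (d^2)\<close>, and a commuting approximate unit extends this from squares to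
  all elements.

  The usual proof of balancedness rests on the continuous functional calculus and on spectral
  synthesis. The argument here is elementary. It suffices to treat the unitaries
  \<open>u = sqrt (1 - a^2) + \<i> a\<close> of the unitization, whose powers and inverse powers are bounded, and to show
  \<open>\<psi> u 1 = \<psi> 1 u\<close> for every \<open>\<psi>\<close> that vanishes on zero products. For \<open>\<eta>\<close> on the unit circle put
  \<open>d = \<eta> u - u^-1\<close>; this is a sine of a rotated angle, up to a scalar. The absolute value of
  the sine is given by the product \<open>m\<close> of two binomial series \<open>sqrt (1 - \<eta> u^2)\<close> and
  \<open>sqrt (1 - u^-2 / \<eta>)\<close>. With \<open>\<mu>^2 = - \<eta>\<close> one has \<open>(d - \<mu> m) (d + \<mu> m) = 0\<close>, whence
  \<open>\<psi> d m = \<psi> m d\<close>. The constant Fourier coefficient in \<open>\<eta>\<close> of this equation says that the third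
  difference of the sequence \<open>n \<mapsto> \<psi> (u^n) (u^-n)\<close> vanishes
  (\<open>zero_product_form_third_difference\<close>). The sequence is bounded, therefore constant
  (\<open>zero_product_form_doubly_power_bounded\<close>).
\<close>

section \<open>The binomial series of the square root\<close>

definition sqrt_coeff :: "nat \<Rightarrow> real"
  where "sqrt_coeff k = (- 1) ^ k * ((1/2) gchoose k)"

lemma sqrt_coeff_0 [simp]: "sqrt_coeff 0 = 1"
  by (simp add: sqrt_coeff_def)

lemma sqrt_coeff_Suc:
  "sqrt_coeff (Suc k) = sqrt_coeff k * (2 * real k - 1) / (2 * real k + 2)"
proof -
  have "(1/2 :: real) * ((1/2) gchoose k)
      = real k * ((1/2) gchoose k) + (real k + 1) * ((1/2) gchoose Suc k)"
    using gbinomial_mult_1[of "1/2::real" k] by (simp add: algebra_simps)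
  hence "((1/2 :: real) gchoose Suc k) = ((1/2) gchoose k) * (1/2 - real k) / (real k + 1)"
    by (simp add: divide_simps) (simp add: algebra_simps)
  note ratio = this
  show ?thesis
    unfolding sqrt_coeff_def ratio by (simp add: divide_simps) (simp add: algebra_simps)
qed

lemma sqrt_coeff_nonpos: "k \<ge> 1 \<Longrightarrow> sqrt_coeff k \<le> 0"
proof (induction k rule: dec_induct)
  case base
  show ?case by (simp add: sqrt_coeff_Suc)
next
  case (step k)
  have "sqrt_coeff k * (2 * real k - 1) \<le> 0"
    using step by (intro mult_nonpos_nonneg) auto
  thus ?case
    by (auto simp: sqrt_coeff_Suc divide_nonpos_pos)
qed

lemma sum_sqrt_coeff: "(\<Sum>k<n. sqrt_coeff k) = - 2 * real n * sqrt_coeff n"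
  by (induction n) (simp_all add: sqrt_coeff_Suc field_simps)

text \<open>Only the zeroth coefficient is positive, so the sum of the absolute values is twice that
  coefficient minus the signed sum, which telescopes to a nonnegative number.\<close>

lemma sum_abs_sqrt_coeff_le: "(\<Sum>k<n. \<bar>sqrt_coeff k\<bar>) \<le> 2"
proof (cases n)
  case (Suc m)
  have "(\<Sum>k<Suc m. \<bar>sqrt_coeff k\<bar>) = 2 - (\<Sum>k<Suc m. sqrt_coeff k)"
    by (induction m) (use sqrt_coeff_nonpos in auto)
  also have "\<dots> \<le> 2"
    unfolding sum_sqrt_coeff using sqrt_coeff_nonpos[of "Suc m"]
    by (simp add: mult_nonpos_nonpos)
  finally show ?thesis using Suc by simp
qed auto

lemma summable_abs_sqrt_coeff: "summable (\<lambda>k. \<bar>sqrt_coeff k\<bar>)"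
  by (rule bounded_imp_summable[where B = 2])
    (use sum_abs_sqrt_coeff_le[of "Suc _"] in \<open>auto simp: lessThan_Suc_atMost\<close>)

lemma sqrt_coeff_convolution:
  "(\<Sum>i\<le>n. sqrt_coeff i * sqrt_coeff (n - i)) = (if n = 0 then 1 else if n = 1 then - 1 else 0)"
proof -
  have "(\<Sum>i\<le>n. sqrt_coeff i * sqrt_coeff (n - i))
      = (\<Sum>i\<le>n. (- 1) ^ n * ((1/2 gchoose i) * (1/2 gchoose (n - i))))"
    by (rule sum.cong) (auto simp: sqrt_coeff_def simp flip: power_add)
  also have "\<dots> = (- 1) ^ n * (\<Sum>i=0..n. (1/2 gchoose i) * (1/2 gchoose (n - i)))"
    by (simp add: sum_distrib_left atMost_atLeast0)
  also have "(\<Sum>i=0..n. (1/2 gchoose i) * (1/2 gchoose (n - i))) = ((1/2 + 1/2 :: real) gchoose n)"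
    by (rule gbinomial_Vandermonde)
  also have "\<dots> = real (1 choose n)"
    using binomial_gbinomial[of 1 n, where ?'a = real] by simp
  finally show ?thesis
    by (cases "n \<le> 1") (auto simp: le_Suc_eq)
qed

text \<open>The coefficients of \<open>\<bar>1 - z\<bar> = sqrt (1 - z) * sqrt (1 - 1/z)\<close> at \<open>z^0\<close> and \<open>z^1\<close>
  are the correlations of the sequence with itself and with its shift. Their ratio is \<open>-3\<close>; the
  reason is that \<open>-2 * n * (sqrt_coeff n)^2\<close> is a discrete antiderivative.\<close>

lemma sum_sqrt_coeff_correlation:
  "(\<Sum>k<n. sqrt_coeff k ^ 2) + 3 * (\<Sum>k<n. sqrt_coeff k * sqrt_coeff (Suc k))
     = - 2 * real n * sqrt_coeff n ^ 2"
proof (induction n)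
  case (Suc n)
  have "sqrt_coeff n ^ 2 + 3 * (sqrt_coeff n * sqrt_coeff (Suc n))
     = - 2 * real (Suc n) * sqrt_coeff (Suc n) ^ 2 + 2 * real n * sqrt_coeff n ^ 2"
    by (simp add: sqrt_coeff_Suc divide_simps) (simp add: algebra_simps power2_eq_square)
  with Suc show ?case by (simp add: algebra_simps)
qed simp

lemma tendsto_times_sqrt_coeff_power2: "(\<lambda>n. real n * sqrt_coeff n ^ 2) \<longlonglongrightarrow> 0"
proof (rule tendsto_0_le[where K = 1])
  show "sqrt_coeff \<longlonglongrightarrow> 0"
    using summable_LIMSEQ_zero[OF summable_abs_sqrt_coeff] by (simp add: tendsto_rabs_zero_iff)
  have "norm (real n * sqrt_coeff n ^ 2) \<le> norm (sqrt_coeff n) * 1" for n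
  proof (cases "n = 0")
    case False
    have "(\<Sum>j<n. sqrt_coeff j) \<le> (\<Sum>j<n. \<bar>sqrt_coeff j\<bar>)"
      by (rule sum_mono) simp
    hence "- 2 * real n * sqrt_coeff n \<le> 2"
      using sum_abs_sqrt_coeff_le[of n] sum_sqrt_coeff[of n] by linarith
    moreover have "sqrt_coeff n \<le> 0" using False sqrt_coeff_nonpos[of n] by simp
    ultimately have "real n * \<bar>sqrt_coeff n\<bar> \<le> 1" by simp
    hence "real n * \<bar>sqrt_coeff n\<bar> * \<bar>sqrt_coeff n\<bar> \<le> 1 * \<bar>sqrt_coeff n\<bar>"
      by (rule mult_right_mono) simp
    thus ?thesis by (simp add: power2_eq_square abs_mult mult.assoc)
  qed simp
  thus "\<forall>\<^sub>F n in sequentially. norm (real n * sqrt_coeff n ^ 2) \<le> norm (sqrt_coeff n) * 1"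
    by simp
qed

lemma abs_sqrt_coeff_le: "\<bar>sqrt_coeff k\<bar> \<le> 2"
proof -
  have "\<bar>sqrt_coeff k\<bar> \<le> (\<Sum>j<Suc k. \<bar>sqrt_coeff j\<bar>)"
    by (rule member_le_sum) auto
  thus ?thesis using sum_abs_sqrt_coeff_le[of "Suc k"] by linarith
qed

lemma summable_sqrt_coeff_correlation: "summable (\<lambda>k. sqrt_coeff k * sqrt_coeff (k + e))"
proof (rule summable_comparison_test')
  show "norm (sqrt_coeff k * sqrt_coeff (k + e)) \<le> \<bar>sqrt_coeff k\<bar> * 2" for k
    using abs_sqrt_coeff_le by (simp add: abs_mult mult_left_mono)
qed (intro summable_mult2 summable_abs_sqrt_coeff)

lemma suminf_sqrt_coeff_correlation:
  "(\<Sum>k. sqrt_coeff k * sqrt_coeff (k + 0)) = - 3 * (\<Sum>k. sqrt_coeff k * sqrt_coeff (k + 1))"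
proof -
  let ?A = "\<lambda>e. \<Sum>k. sqrt_coeff k * sqrt_coeff (k + e)"
  let ?f = "\<lambda>n. - 2 * (real n * sqrt_coeff n ^ 2)"
  have "(\<lambda>n. (\<Sum>k<n. sqrt_coeff k * sqrt_coeff (k + 0))
          + 3 * (\<Sum>k<n. sqrt_coeff k * sqrt_coeff (k + 1))) \<longlonglongrightarrow> ?A 0 + 3 * ?A 1"
    by (intro tendsto_intros summable_LIMSEQ summable_sqrt_coeff_correlation)
  moreover have "(\<Sum>k<n. sqrt_coeff k * sqrt_coeff (k + 0))
          + 3 * (\<Sum>k<n. sqrt_coeff k * sqrt_coeff (k + 1)) = ?f n" for n
    using sum_sqrt_coeff_correlation[of n] by (simp add: power2_eq_square)
  ultimately have "?f \<longlonglongrightarrow> ?A 0 + 3 * ?A 1" by simp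
  moreover have "?f \<longlonglongrightarrow> - 2 * 0"
    by (intro tendsto_intros tendsto_times_sqrt_coeff_power2)
  ultimately have "?A 0 + 3 * ?A 1 = - 2 * 0"
    by (rule LIMSEQ_unique)
  thus ?thesis by simp
qed

lemma suminf_sqrt_coeff_correlation_nonzero: "(\<Sum>k. sqrt_coeff k * sqrt_coeff (k + 1)) \<noteq> 0"
proof -
  have "0 < (\<Sum>k. sqrt_coeff k * sqrt_coeff (k + 0))"
    by (rule suminf_pos2[where i = 0]) (use summable_sqrt_coeff_correlation[of 0] in auto)
  thus ?thesis using suminf_sqrt_coeff_correlation by auto
qed

section \<open>Square roots of power-bounded perturbations of the unit\<close>

definition sqrt_series :: "'a \<Rightarrow> 'a::{real_normed_algebra_1,banach}"
  where "sqrt_series x = (\<Sum>k. sqrt_coeff k *\<^sub>R x ^ k)"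

text \<open>Since the coefficients are absolutely summable, the series converges as soon as the powers of
  \<open>x\<close> are bounded; the norm of \<open>x\<close> itself may exceed 1. This matters because the unitaries used
  below are only known to be power bounded in the norm of the unitization.\<close>

context
  fixes x :: "'a::{real_normed_algebra_1,banach}" and K :: real
  assumes power_bounded: "\<And>n. norm (x ^ n) \<le> K"
begin

lemma norm_sqrt_series_term_le: "norm (sqrt_coeff k *\<^sub>R x ^ k) \<le> \<bar>sqrt_coeff k\<bar> * K"
  using power_bounded[of k] by (simp add: mult_left_mono)

lemma summable_norm_sqrt_series: "summable (\<lambda>k. norm (sqrt_coeff k *\<^sub>R x ^ k))"
  by (rule summable_comparison_test'[where N = 0 and g = "\<lambda>k. \<bar>sqrt_coeff k\<bar> * K"])
    (use norm_sqrt_series_term_le in \<open>auto intro: summable_mult2 summable_abs_sqrt_coeff\<close>)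

lemma sqrt_series_squared: "sqrt_series x * sqrt_series x = 1 - x"
proof -
  let ?f = "\<lambda>k. sqrt_coeff k *\<^sub>R x ^ k"
  have "(\<Sum>i\<le>k. ?f i * ?f (k - i))
      = (if k = 0 then 1 else if k = 1 then - x else 0)" for k
  proof -
    have "(\<Sum>i\<le>k. ?f i * ?f (k - i))
        = (\<Sum>i\<le>k. (sqrt_coeff i * sqrt_coeff (k - i)) *\<^sub>R x ^ k)"
      by (rule sum.cong) (simp_all flip: power_add)
    also have "\<dots> = (\<Sum>i\<le>k. sqrt_coeff i * sqrt_coeff (k - i)) *\<^sub>R x ^ k"
      by (simp only: scaleR_left.sum)
    finally show ?thesis by (simp add: sqrt_coeff_convolution)
  qed
  moreover have "(\<lambda>k. \<Sum>i\<le>k. ?f i * ?f (k - i)) sums (sqrt_series x * sqrt_series x)"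
    unfolding sqrt_series_def
    by (rule Cauchy_product_sums[OF summable_norm_sqrt_series summable_norm_sqrt_series])
  moreover have "(\<lambda>k. if k = 0 then 1 else if k = 1 then - x else 0) sums (1 - x)"
    using sums_finite[of "{0, 1}" "\<lambda>k. if k = 0 then 1 else if k = 1 then - x else 0"]
    by simp
  ultimately show ?thesis by (simp add: sums_iff)
qed

lemma sqrt_series_commute:
  assumes "y * x = x * y"
  shows "y * sqrt_series x = sqrt_series x * y"
proof -
  have comm: "y * x ^ k = x ^ k * y" for k
    using assms by (metis power_commuting_commutes)
  have sm: "summable (\<lambda>k. sqrt_coeff k *\<^sub>R x ^ k)"
    by (rule summable_norm_cancel[OF summable_norm_sqrt_series])
  show ?thesis
    unfolding sqrt_series_def suminf_mult[OF sm, symmetric] suminf_mult2[OF sm]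
    by (simp add: comm)
qed

lemma sqrt_series_partial_sum_error:
  "norm (sqrt_series x - (\<Sum>k<n. sqrt_coeff k *\<^sub>R x ^ k)) \<le> (\<Sum>k. \<bar>sqrt_coeff (k + n)\<bar>) * K"
proof -
  let ?f = "\<lambda>k. sqrt_coeff k *\<^sub>R x ^ k"
  have sm: "summable (\<lambda>k. \<bar>sqrt_coeff (k + n)\<bar>)"
    by (rule summable_ignore_initial_segment[OF summable_abs_sqrt_coeff])
  have "sqrt_series x - (\<Sum>k<n. ?f k) = (\<Sum>k. ?f (k + n))"
    unfolding sqrt_series_def
    using suminf_minus_initial_segment[OF summable_norm_cancel[OF summable_norm_sqrt_series]] by simp
  also have "norm \<dots> \<le> (\<Sum>k. \<bar>sqrt_coeff (k + n)\<bar> * K)"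
    using norm_sqrt_series_term_le by (intro norm_suminf_le summable_mult2 sm)
  finally show ?thesis using sm by (simp add: suminf_mult2)
qed

end

section \<open>Averages over the circle\<close>

text \<open>Fourier coefficients of Laurent polynomials are extracted by averaging over all roots of unity
  of an order exceeding the degrees, which avoids integration.\<close>

definition unit_root :: "nat \<Rightarrow> nat \<Rightarrow> complex"
  where "unit_root N i = cis (2 * pi * real i / real N)"

lemma unit_root_mult_cnj [simp]: "unit_root N i * cnj (unit_root N i) = 1"
  "cnj (unit_root N i) * unit_root N i = 1"
  by (simp_all add: unit_root_def cis_cnj cis_mult)

lemma norm_unit_root [simp]: "cmod (unit_root N i) = 1"
  by (simp add: unit_root_def)

lemma sum_unit_root:
  assumes "j < N" "k < N"
  shows "(\<Sum>i<N. unit_root N i ^ j * cnj (unit_root N i) ^ k) = (if j = k then of_nat N else 0)"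
proof (cases "j = k")
  case True
  thus ?thesis by (simp flip: power_mult_distrib)
next
  case False
  define r where "r = unit_root N j * cnj (unit_root N k)"
  have "unit_root N i ^ j * cnj (unit_root N i) ^ k = r ^ i" for i
    by (simp add: r_def unit_root_def cis_cnj cis_mult Complex.DeMoivre algebra_simps diff_divide_distrib)
  moreover have "r \<noteq> 1"
  proof
    assume "r = 1"
    hence "unit_root N j * (cnj (unit_root N k) * unit_root N k) = unit_root N k"
      by (simp only: r_def mult.assoc[symmetric] mult_1)
    hence "unit_root N j = unit_root N k" by simp
    moreover have "inj_on (unit_root N) {..<N}"
      using bij_betw_roots_unity[of N] assms by (simp add: bij_betw_def unit_root_def[abs_def])
    ultimately show False using assms False by (auto dest: inj_onD)
  qed
  moreover have "r ^ N = 1"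
  proof -
    have "unit_root N i ^ N = 1" for i
    proof -
      have "unit_root N i ^ N = cis (2 * pi * of_nat i)"
        using assms by (simp add: unit_root_def Complex.DeMoivre)
      thus ?thesis by (simp add: cis_multiple_2pi)
    qed
    thus ?thesis by (simp add: r_def power_mult_distrib flip: complex_cnj_power)
  qed
  ultimately show ?thesis using False by (simp add: geometric_sum)
qed

lemma scaleC_power:
  fixes x :: "'a::{complex_normed_algebra,real_normed_algebra_1}"
  shows "(c *\<^sub>C x) ^ n = c ^ n *\<^sub>C x ^ n"
  by (induction n) (simp_all add: scaleC_one scaleC_mult_left scaleC_mult_right scaleC_scaleC mult.commute)

lemma scaleR_scaleC: "r *\<^sub>R c *\<^sub>C x = c *\<^sub>C r *\<^sub>R (x::'a::complex_vector)"
  by (simp add: scaleC_scaleC mult.commute flip: scaleC_of_real)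

text \<open>The coefficients of \<open>\<eta>^0\<close> (for \<open>e = 0\<close>) and of \<open>\<eta>^-1\<close> (for \<open>e = 1\<close>) in the truncated
  Laurent series of \<open>sqrt (1 - \<eta> x) * sqrt (1 - y / \<eta>)\<close>. The second factor is truncated one step later so
  that each summand of the first factor finds its partner in both cases.\<close>

lemma average_sqrt_series_partial:
  fixes x y :: "'a::{complex_normed_algebra,real_normed_algebra_1}"
  assumes inv: "x * y = 1" and e: "e \<le> 1"
  shows "(1 / real (Suc n)) *\<^sub>R (\<Sum>i<Suc n. unit_root (Suc n) i ^ e *\<^sub>C
            ((\<Sum>j<n. sqrt_coeff j *\<^sub>R (unit_root (Suc n) i *\<^sub>C x) ^ j) *
             (\<Sum>k<Suc n. sqrt_coeff k *\<^sub>R (cnj (unit_root (Suc n) i) *\<^sub>C y) ^ k)))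
       = (\<Sum>j<n. sqrt_coeff j * sqrt_coeff (j + e)) *\<^sub>R y ^ e"
proof -
  let ?N = "Suc n" and ?\<eta> = "unit_root (Suc n)" and ?s = sqrt_coeff
  have xy: "x ^ j * y ^ (j + e) = y ^ e" for j
  proof (induction j)
    case (Suc j)
    have "x ^ Suc j * y ^ (Suc j + e) = x ^ j * (x * y) * y ^ (j + e)"
      by (simp only: power_Suc2[of x] add_Suc power_Suc[of y] mult.assoc)
    thus ?case using inv Suc by simp
  qed simp
  have "(\<Sum>i<?N. ?\<eta> i ^ e *\<^sub>C ((\<Sum>j<n. ?s j *\<^sub>R (?\<eta> i *\<^sub>C x) ^ j) *
             (\<Sum>k<?N. ?s k *\<^sub>R (cnj (?\<eta> i) *\<^sub>C y) ^ k)))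
      = (\<Sum>i<?N. \<Sum>j<n. \<Sum>k<?N. (?\<eta> i ^ (j + e) * cnj (?\<eta> i) ^ k) *\<^sub>C
             ((?s j * ?s k) *\<^sub>R (x ^ j * y ^ k)))"
    by (simp only: sum_product complex_vector.scale_sum_right scaleC_power)
       (simp add: scaleC_mult_left scaleC_mult_right scaleR_scaleC scaleC_scaleC power_add mult_ac
          del: sum.lessThan_Suc)
  also have "\<dots> = (\<Sum>j<n. \<Sum>k<?N. (\<Sum>i<?N. ?\<eta> i ^ (j + e) * cnj (?\<eta> i) ^ k) *\<^sub>C
             ((?s j * ?s k) *\<^sub>R (x ^ j * y ^ k)))"
    by (subst sum.swap, rule sum.cong[OF refl], subst sum.swap)
       (simp only: complex_vector.scale_sum_left)
  also have "\<dots> = (\<Sum>j<n. \<Sum>k<?N. if j + e = k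
             then complex_of_real (real ?N) *\<^sub>C ((?s j * ?s k) *\<^sub>R (x ^ j * y ^ k)) else 0)"
    using e by (intro sum.cong refl) (simp add: sum_unit_root del: sum.lessThan_Suc)
  also have "\<dots> = (\<Sum>j<n. real ?N *\<^sub>R ((?s j * ?s (j + e)) *\<^sub>R y ^ e))"
    using e by (intro sum.cong refl)
      (simp add: sum.delta' xy scaleC_of_real del: sum.lessThan_Suc of_real_of_nat_eq of_nat_Suc)
  also have "\<dots> = real ?N *\<^sub>R ((\<Sum>j<n. ?s j * ?s (j + e)) *\<^sub>R y ^ e)"
    by (simp only: scaleR_left.sum scaleR_right.sum)
  finally show ?thesis by (simp del: sum.lessThan_Suc of_nat_Suc)
qed

lemma norm_scaleC_power_le:
  fixes x :: "'a::{complex_normed_algebra,real_normed_algebra_1}"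
  assumes "norm (x ^ n) \<le> K" "cmod c = 1"
  shows "norm ((c *\<^sub>C x) ^ n) \<le> K"
  using assms by (simp add: scaleC_power norm_scaleC norm_power)

text \<open>The truncation error is bounded uniformly on the circle by the tail of the coefficients, so the
  averages converge to the Fourier coefficients of the full product.\<close>

lemma average_sqrt_series_tendsto:
  fixes x y :: "'a::{complex_normed_algebra,real_normed_algebra_1,banach}"
  assumes inv: "x * y = 1" and e: "e \<le> 1"
    and bx: "\<And>n. norm (x ^ n) \<le> K" and byy: "\<And>n. norm (y ^ n) \<le> K"
  shows "(\<lambda>n. (1 / real (Suc n)) *\<^sub>R (\<Sum>i<Suc n. unit_root (Suc n) i ^ e *\<^sub>C
            (sqrt_series (unit_root (Suc n) i *\<^sub>C x) * sqrt_series (cnj (unit_root (Suc n) i) *\<^sub>C y))))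
       \<longlonglongrightarrow> (\<Sum>k. sqrt_coeff k * sqrt_coeff (k + e)) *\<^sub>R y ^ e" (is "?M \<longlonglongrightarrow> ?L")
proof -
  let ?P = "\<lambda>n z. \<Sum>k<n. sqrt_coeff k *\<^sub>R z ^ k"
  define tail where "tail n = (\<Sum>k. \<bar>sqrt_coeff (k + n)\<bar>)" for n
  define err where "err n = tail n * K * (tail 0 * K) + 2 * K * (tail (Suc n) * K)" for n
  have K: "K \<ge> 0" using order_trans[OF norm_ge_zero bx] .
  have tail_nonneg: "tail n \<ge> 0" for n
    unfolding tail_def
    by (intro suminf_nonneg summable_ignore_initial_segment summable_abs_sqrt_coeff) auto
  have tail0: "tail \<longlonglongrightarrow> 0"
  proof -
    have "tail = (\<lambda>n. tail 0 - (\<Sum>k<n. \<bar>sqrt_coeff k\<bar>))"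
      using suminf_minus_initial_segment[OF summable_abs_sqrt_coeff]
      by (simp add: tail_def fun_eq_iff)
    moreover have "(\<lambda>n. tail 0 - (\<Sum>k<n. \<bar>sqrt_coeff k\<bar>)) \<longlonglongrightarrow> tail 0 - tail 0"
      using summable_LIMSEQ[OF summable_abs_sqrt_coeff]
      by (intro tendsto_intros) (simp add: tail_def)
    ultimately show ?thesis by (metis diff_self)
  qed
  have err0: "err \<longlonglongrightarrow> 0"
  proof -
    have "err \<longlonglongrightarrow> 0 * K * (tail 0 * K) + 2 * K * (0 * K)"
      unfolding err_def[abs_def] by (intro tendsto_intros tail0 LIMSEQ_Suc)
    thus ?thesis by simp
  qed
  have prod_err: "norm (sqrt_series p * sqrt_series q - ?P n p * ?P (Suc n) q) \<le> err n"
    if p: "\<And>n. norm (p ^ n) \<le> K" and q: "\<And>n. norm (q ^ n) \<le> K" for p q :: 'a and n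
  proof -
    have 1: "norm (sqrt_series p - ?P n p) \<le> tail n * K"
      unfolding tail_def by (rule sqrt_series_partial_sum_error[OF p])
    have 2: "norm (sqrt_series q - ?P (Suc n) q) \<le> tail (Suc n) * K"
      unfolding tail_def by (rule sqrt_series_partial_sum_error[OF q])
    have 3: "norm (sqrt_series q) \<le> tail 0 * K"
      using sqrt_series_partial_sum_error[OF q, of 0] by (simp add: tail_def)
    have 4: "norm (?P n p) \<le> 2 * K"
    proof -
      have "norm (?P n p) \<le> (\<Sum>k<n. \<bar>sqrt_coeff k\<bar> * K)"
        by (rule order.trans[OF norm_sum sum_mono[OF norm_sqrt_series_term_le[OF p]]])
      also have "\<dots> = (\<Sum>k<n. \<bar>sqrt_coeff k\<bar>) * K" by (simp add: sum_distrib_right)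
      also have "\<dots> \<le> 2 * K" by (intro mult_right_mono sum_abs_sqrt_coeff_le K)
      finally show ?thesis .
    qed
    have "sqrt_series p * sqrt_series q - ?P n p * ?P (Suc n) q
        = (sqrt_series p - ?P n p) * sqrt_series q + ?P n p * (sqrt_series q - ?P (Suc n) q)"
      by (simp add: algebra_simps)
    also have "norm \<dots> \<le> norm (sqrt_series p - ?P n p) * norm (sqrt_series q)
                    + norm (?P n p) * norm (sqrt_series q - ?P (Suc n) q)"
      by (rule order.trans[OF norm_triangle_ineq add_mono[OF norm_mult_ineq norm_mult_ineq]])
    also have "\<dots> \<le> err n"
      unfolding err_def using 1 2 3 4 K tail_nonneg by (intro add_mono mult_mono) auto
    finally show ?thesis .
  qed
  define A where "A n = (\<Sum>j<n. sqrt_coeff j * sqrt_coeff (j + e)) *\<^sub>R y ^ e" for n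
  have "norm (?M n - A n) \<le> norm (err n) * 1" for n
  proof -
    let ?N = "Suc n" and ?\<eta> = "unit_root (Suc n)"
    let ?S = "\<lambda>i. sqrt_series (?\<eta> i *\<^sub>C x) * sqrt_series (cnj (?\<eta> i) *\<^sub>C y)"
    let ?Q = "\<lambda>i. ?P n (?\<eta> i *\<^sub>C x) * ?P ?N (cnj (?\<eta> i) *\<^sub>C y)"
    have "?M n - A n = (1 / real ?N) *\<^sub>R (\<Sum>i<?N. ?\<eta> i ^ e *\<^sub>C (?S i - ?Q i))"
      unfolding A_def average_sqrt_series_partial[OF inv e, symmetric]
      by (simp only: scaleR_diff_right[symmetric] sum_subtractf[symmetric]
            complex_vector.scale_right_diff_distrib)
    hence "norm (?M n - A n) = (1 / real ?N) * norm (\<Sum>i<?N. ?\<eta> i ^ e *\<^sub>C (?S i - ?Q i))"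
      by (simp only: norm_scaleR) simp
    moreover have "norm (\<Sum>i<?N. ?\<eta> i ^ e *\<^sub>C (?S i - ?Q i)) \<le> (\<Sum>i<?N. err n)"
    proof (rule sum_norm_le)
      fix i
      have "norm (?S i - ?Q i) \<le> err n"
        by (rule prod_err) (simp_all add: norm_scaleC_power_le bx byy)
      thus "norm (?\<eta> i ^ e *\<^sub>C (?S i - ?Q i)) \<le> err n"
        by (simp add: norm_scaleC norm_power)
    qed
    hence "(1 / real ?N) * norm (\<Sum>i<?N. ?\<eta> i ^ e *\<^sub>C (?S i - ?Q i))
        \<le> (1 / real ?N) * (\<Sum>i<?N. err n)"
      by (rule mult_left_mono) simp
    moreover have "(1 / real ?N) * (\<Sum>i<?N. err n) = err n"
      by (simp del: of_nat_Suc sum.lessThan_Suc)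
    ultimately show ?thesis by simp
  qed
  hence "(\<lambda>n. ?M n - A n) \<longlonglongrightarrow> 0"
    by (intro tendsto_0_le[OF err0, where K = 1] always_eventually) blast
  moreover have "A \<longlonglongrightarrow> ?L"
    unfolding A_def[abs_def] by (intro tendsto_intros summable_LIMSEQ summable_sqrt_coeff_correlation)
  ultimately have "(\<lambda>n. (?M n - A n) + A n) \<longlonglongrightarrow> 0 + ?L"
    by (rule tendsto_add)
  thus ?thesis by (simp only: diff_add_cancel add_0_left)
qed

section \<open>Bilinear forms vanishing on zero products\<close>

text \<open>The example in mind is \<open>\<phi> x y = T x * T y\<close> for a bounded linear map \<open>T\<close> that preserves
  zero products.\<close>

definition zero_product_form ::
  "('a::complex_normed_algebra \<Rightarrow> 'a \<Rightarrow> 'b::complex_normed_vector) \<Rightarrow> bool"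
  where "zero_product_form \<phi> \<longleftrightarrow> bounded_bilinear \<phi>
    \<and> (\<forall>c x y. \<phi> (c *\<^sub>C x) y = c *\<^sub>C \<phi> x y \<and> \<phi> x (c *\<^sub>C y) = c *\<^sub>C \<phi> x y)
    \<and> (\<forall>x y. x * y = 0 \<longrightarrow> \<phi> x y = 0)"

text \<open>If \<open>\<mu>^2 = c\<close>, then \<open>d - \<mu> m\<close> and \<open>d + \<mu> m\<close> annihilate each other in both
  orders. Subtracting the two resulting equations leaves only the mixed terms.\<close>

lemma zero_product_form_commuting_square_roots:
  fixes \<psi> :: "'a::complex_normed_algebra \<Rightarrow> 'a \<Rightarrow> 'b::complex_normed_vector"
  assumes \<psi>: "zero_product_form \<psi>"
    and comm: "d * m = m * d" and sq: "d * d = c *\<^sub>C (m * m)" and c: "c \<noteq> 0"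
  shows "\<psi> d m = \<psi> m d"
proof -
  interpret bounded_bilinear \<psi> using \<psi> by (simp add: zero_product_form_def)
  have sc: "\<psi> (c *\<^sub>C x) y = c *\<^sub>C \<psi> x y" "\<psi> x (c *\<^sub>C y) = c *\<^sub>C \<psi> x y" for c x y
    using \<psi> by (auto simp: zero_product_form_def)
  have zp: "x * y = 0 \<Longrightarrow> \<psi> x y = 0" for x y
    using \<psi> by (auto simp: zero_product_form_def)
  define \<mu> where "\<mu> = csqrt c"
  have \<mu>: "\<mu> * \<mu> = c" "\<mu> \<noteq> 0"
    using c power2_csqrt[of c] by (auto simp: \<mu>_def power2_eq_square)
  have "(d - \<mu> *\<^sub>C m) * (d + \<mu> *\<^sub>C m) = 0" "(d + \<mu> *\<^sub>C m) * (d - \<mu> *\<^sub>C m) = 0"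
    using comm sq \<mu>(1)
    by (simp_all add: algebra_simps scaleC_mult_left scaleC_mult_right scaleC_scaleC)
  hence "\<psi> (d - \<mu> *\<^sub>C m) (d + \<mu> *\<^sub>C m) = \<psi> (d + \<mu> *\<^sub>C m) (d - \<mu> *\<^sub>C m)"
    by (simp add: zp)
  hence "2 *\<^sub>R (\<mu> *\<^sub>C (\<psi> d m - \<psi> m d)) = 0"
    by (simp add: add_left add_right diff_left diff_right sc algebra_simps scaleR_2
        complex_vector.scale_right_diff_distrib)
  thus ?thesis using \<mu>(2) by simp
qed

lemma zero_product_form_comp:
  fixes f g :: "'c::complex_normed_algebra \<Rightarrow> 'a::complex_normed_algebra"
  assumes \<phi>: "zero_product_form \<phi>"
    and f: "bounded_linear f" "\<And>c x. f (c *\<^sub>C x) = c *\<^sub>C f x"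
    and g: "bounded_linear g" "\<And>c x. g (c *\<^sub>C x) = c *\<^sub>C g x"
    and fg: "\<And>x y. x * y = 0 \<Longrightarrow> f x * g y = 0"
  shows "zero_product_form (\<lambda>x y. \<phi> (f x) (g y))"
  using assms bounded_bilinear.comp[OF _ f(1) g(1), of \<phi>] by (simp add: zero_product_form_def)

lemma zero_product_form_shift:
  assumes "zero_product_form \<phi>"
  shows "zero_product_form (\<lambda>x y. \<phi> (p * x) (y * q))"
proof (rule zero_product_form_comp[OF assms])
  show "p * x * (y * q) = 0" if "x * y = 0" for x y
  proof -
    have "p * x * (y * q) = p * (x * y) * q" by (simp only: mult.assoc)
    thus ?thesis using that by simp
  qed
qed (simp_all add: bounded_linear_mult_right bounded_linear_mult_left scaleC_mult_left scaleC_mult_right)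

text \<open>For \<open>\<eta>\<close> on the unit circle the product \<open>m\<close> of the square roots of \<open>1 - \<eta> u^2\<close> and of
  \<open>1 - v^2 / \<eta>\<close> plays the role of an absolute value: its square is \<open>-1/\<eta>\<close> times the square of
  \<open>d = \<eta> u - v\<close>. Hence \<open>\<psi> d m = \<psi> m d\<close>. As \<open>d\<close> involves only two frequencies in \<open>\<eta>\<close>, the
  constant Fourier coefficient of this identity is a finite relation between values of \<open>\<psi>\<close> at powers
  of \<open>u\<close> and \<open>v\<close>. The ratio \<open>-3\<close> of the two correlations makes it a vanishing third difference.\<close>

lemma zero_product_form_third_difference:
  fixes \<psi> :: "'a::{complex_normed_algebra,real_normed_algebra_1,banach} \<Rightarrow> 'a \<Rightarrow> 'b::complex_normed_vector"
  assumes \<psi>: "zero_product_form \<psi>"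
    and inv: "u * v = 1" "v * u = 1"
    and bdd: "\<And>n. norm (u ^ n) \<le> K" "\<And>n. norm (v ^ n) \<le> K"
  shows "\<psi> (v * v) u + 3 *\<^sub>R \<psi> 1 v = \<psi> u (v * v) + 3 *\<^sub>R \<psi> v 1"
proof -
  interpret bounded_bilinear \<psi> using \<psi> by (simp add: zero_product_form_def)
  have sc: "\<psi> (c *\<^sub>C x) y = c *\<^sub>C \<psi> x y" "\<psi> x (c *\<^sub>C y) = c *\<^sub>C \<psi> x y" for c x y
    using \<psi> by (auto simp: zero_product_form_def)
  define x y where "x = u * u" and "y = v * v"
  have xy: "x * y = 1" "y * x = 1"
    unfolding x_def y_def using inv by (metis mult.assoc mult_1_left)+
  have bx: "norm (x ^ n) \<le> K" and byy: "norm (y ^ n) \<le> K" for n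
    using bdd[of "2 * n"] by (simp_all add: x_def y_def power_mult power2_eq_square)
  define m where "m \<eta> = sqrt_series (\<eta> *\<^sub>C x) * sqrt_series (cnj \<eta> *\<^sub>C y)" for \<eta>
  define M where "M e n = (1 / real (Suc n)) *\<^sub>R
      (\<Sum>i<Suc n. unit_root (Suc n) i ^ e *\<^sub>C m (unit_root (Suc n) i))" for e n
  have balanced: "\<psi> u (\<eta> *\<^sub>C m \<eta>) - \<psi> v (m \<eta>) = \<psi> (\<eta> *\<^sub>C m \<eta>) u - \<psi> (m \<eta>) v"
    if \<eta>: "\<eta> * cnj \<eta> = 1" "cmod \<eta> = 1" for \<eta>
  proof -
    define p q d where "p = \<eta> *\<^sub>C x" and "q = cnj \<eta> *\<^sub>C y" and "d = \<eta> *\<^sub>C u - v"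
    have pq: "p * q = 1" "q * p = 1"
      using xy \<eta> by (simp_all add: p_def q_def scaleC_mult_left scaleC_mult_right scaleC_scaleC
          scaleC_one mult.commute)
    have bp: "norm (p ^ n) \<le> K" and bq: "norm (q ^ n) \<le> K" for n
      using bx byy \<eta>(2) by (simp_all add: p_def q_def norm_scaleC_power_le)
    have uq: "u * y = v" "y * u = v" and vx: "v * x = u" "x * v = u"
      using inv unfolding x_def y_def by (metis mult.assoc mult_1_left mult_1_right)+
    have dp: "d * p = p * d"
      using vx by (simp add: d_def p_def algebra_simps scaleC_mult_left scaleC_mult_right)
         (simp add: x_def mult.assoc)
    have dq: "d * q = q * d"
      using uq by (simp add: d_def q_def algebra_simps scaleC_mult_left scaleC_mult_right)
         (simp add: y_def mult.assoc)
    have Spq: "sqrt_series q * sqrt_series p = sqrt_series p * sqrt_series q"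
      using sqrt_series_commute[OF bp sqrt_series_commute[OF bq, symmetric]] pq by simp
    have dm: "d * m \<eta> = m \<eta> * d"
      using sqrt_series_commute[OF bp dp] sqrt_series_commute[OF bq dq]
      unfolding m_def p_def[symmetric] q_def[symmetric] by (metis mult.assoc)
    have "m \<eta> * m \<eta> = (sqrt_series p * sqrt_series p) * (sqrt_series q * sqrt_series q)"
      using Spq unfolding m_def p_def[symmetric] q_def[symmetric] by (metis mult.assoc)
    also have "\<dots> = 1 + 1 - p - q"
      using pq by (simp add: sqrt_series_squared[OF bp] sqrt_series_squared[OF bq] algebra_simps)
    finally have mm: "m \<eta> * m \<eta> = 1 + 1 - p - q" .
    have "d * d = \<eta> *\<^sub>C p - \<eta> *\<^sub>C 1 - \<eta> *\<^sub>C 1 + y"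
      using inv by (simp add: d_def p_def x_def y_def algebra_simps scaleC_mult_left scaleC_mult_right)
    also have "\<dots> = (- \<eta>) *\<^sub>C (m \<eta> * m \<eta>)"
      using \<eta>(1) by (simp add: mm q_def complex_vector.scale_right_distrib
          complex_vector.scale_right_diff_distrib scaleC_scaleC scaleC_one algebra_simps
          del: one_add_one)
    finally have "\<psi> d (m \<eta>) = \<psi> (m \<eta>) d"
      using \<eta>(2) by (intro zero_product_form_commuting_square_roots[OF \<psi> dm, where c = "- \<eta>"]) auto
    thus ?thesis
      by (simp add: d_def diff_left diff_right sc)
  qed
  have "\<psi> u (M 1 n) - \<psi> v (M 0 n) = \<psi> (M 1 n) u - \<psi> (M 0 n) v" for n
  proof -
    let ?\<eta> = "unit_root (Suc n)"
    have "\<psi> u (M 1 n) - \<psi> v (M 0 n)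
        = (1 / real (Suc n)) *\<^sub>R (\<Sum>i<Suc n. \<psi> u (?\<eta> i *\<^sub>C m (?\<eta> i)) - \<psi> v (m (?\<eta> i)))"
      by (simp only: M_def scaleR_right sum_right scaleR_diff_right sum_subtractf
          power_0 power_one_right scaleC_one)
    also have "\<dots> = (1 / real (Suc n)) *\<^sub>R (\<Sum>i<Suc n. \<psi> (?\<eta> i *\<^sub>C m (?\<eta> i)) u - \<psi> (m (?\<eta> i)) v)"
      by (simp only: balanced unit_root_mult_cnj norm_unit_root)
    also have "\<dots> = \<psi> (M 1 n) u - \<psi> (M 0 n) v"
      by (simp only: M_def scaleR_left sum_left scaleR_diff_right sum_subtractf
          power_0 power_one_right scaleC_one)
    finally show ?thesis .
  qed
  moreover define A where "A e = (\<Sum>k. sqrt_coeff k * sqrt_coeff (k + e))" for e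
  have lim: "M e \<longlonglongrightarrow> A e *\<^sub>R y ^ e" if "e \<le> 1" for e
    unfolding M_def[abs_def] m_def A_def by (rule average_sqrt_series_tendsto[OF xy(1) that bx byy])
  have "(\<lambda>n. \<psi> u (M 1 n) - \<psi> v (M 0 n)) \<longlonglongrightarrow> \<psi> u (A 1 *\<^sub>R y ^ 1) - \<psi> v (A 0 *\<^sub>R y ^ 0)"
    by (intro tendsto_intros tendsto lim) auto
  moreover have "(\<lambda>n. \<psi> (M 1 n) u - \<psi> (M 0 n) v) \<longlonglongrightarrow> \<psi> (A 1 *\<^sub>R y ^ 1) u - \<psi> (A 0 *\<^sub>R y ^ 0) v"
    by (intro tendsto_intros tendsto lim) auto
  ultimately have "\<psi> u (A 1 *\<^sub>R y ^ 1) - \<psi> v (A 0 *\<^sub>R y ^ 0)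
      = \<psi> (A 1 *\<^sub>R y ^ 1) u - \<psi> (A 0 *\<^sub>R y ^ 0) v"
    using LIMSEQ_unique by simp
  moreover have "A 0 = - 3 * A 1" and nz: "A 1 \<noteq> 0"
    unfolding A_def using suminf_sqrt_coeff_correlation suminf_sqrt_coeff_correlation_nonzero by auto
  ultimately have "A 1 *\<^sub>R (\<psi> (v * v) u + 3 *\<^sub>R \<psi> 1 v) = A 1 *\<^sub>R (\<psi> u (v * v) + 3 *\<^sub>R \<psi> v 1)"
    by (simp add: scaleR_left scaleR_right minus_left minus_right y_def algebra_simps)
  thus ?thesis using nz by simp
qed

lemma bounded_arithmetic_progression_constant:
  fixes F :: "nat \<Rightarrow> 'a::real_normed_vector"
  assumes step: "\<And>n. F (Suc n) = F n + d" and bdd: "\<And>n. norm (F n) \<le> C"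
  shows "d = 0"
proof (rule ccontr)
  assume "d \<noteq> 0"
  have F: "F n = F 0 + real n *\<^sub>R d" for n
    by (induction n) (simp_all add: step scaleR_left_distrib)
  obtain n where n: "2 * C < real n * norm d"
    using reals_Archimedean3[of "norm d"] \<open>d \<noteq> 0\<close> by auto
  have "real n * norm d = norm (F n - F 0)" by (simp add: F[of n])
  also have "\<dots> \<le> C + C" by (rule order.trans[OF norm_triangle_ineq4 add_mono[OF bdd bdd]])
  finally show False using n by simp
qed

text \<open>Applying \<open>zero_product_form_third_difference\<close> to shifted forms shows that the third differences of \<open>F n = \<psi> (u^n) (v^n * u)\<close>
  vanish. So \<open>F\<close> is a polynomial in \<open>n\<close>; being bounded, it is constant, and \<open>F 1 = F 0\<close> is the claim.\<close>

lemma zero_product_form_doubly_power_bounded: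
  fixes \<psi> :: "'a::{complex_normed_algebra,real_normed_algebra_1,banach} \<Rightarrow> 'a \<Rightarrow> 'b::complex_normed_vector"
  assumes \<psi>: "zero_product_form \<psi>"
    and inv: "u * v = 1" "v * u = 1"
    and bdd: "\<And>n. norm (u ^ n) \<le> K" "\<And>n. norm (v ^ n) \<le> K"
  shows "\<psi> u 1 = \<psi> 1 u"
proof -
  have uv: "u ^ n * v ^ n = 1" for n
  proof (induction n)
    case (Suc n)
    have "u ^ Suc n * v ^ Suc n = u ^ n * (u * v) * v ^ n"
      by (simp only: power_Suc2[of u] power_Suc[of v] mult.assoc)
    thus ?case using Suc inv by simp
  qed simp
  (* The factor 1 puts the form into the shape of zero_product_form_shift. *)
  define \<psi>' where "\<psi>' x y = \<psi> (1 * x) (y * u)" for x y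
  have \<psi>': "zero_product_form \<psi>'"
    unfolding \<psi>'_def[abs_def] by (rule zero_product_form_shift[OF \<psi>])
  then interpret bounded_bilinear \<psi>' by (simp add: zero_product_form_def)
  define F where "F n = \<psi>' (u ^ n) (v ^ n)" for n
  have third: "F n + 3 *\<^sub>R F (n + 2) = F (n + 3) + 3 *\<^sub>R F (n + 1)" for n
  proof -
    have cancel: "u * (v * z) = z" for z
      using inv(1) by (simp flip: mult.assoc)
    have p: "u ^ (n + 2) * (v * v) = u ^ n" "u ^ (n + 2) * v = u ^ (n + 1)"
      "u ^ (n + 2) * u = u ^ (n + 3)"
      by (simp_all only: power_add power2_eq_square power3_eq_cube power_one_right mult.assoc
          cancel inv mult_1_right)
    have q: "u * v ^ (n + 1) = v ^ n" "v * v ^ (n + 1) = v ^ (n + 2)" "v * v * v ^ (n + 1) = v ^ (n + 3)"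
      using inv by (simp_all add: numeral_3_eq_3 mult.assoc[symmetric])
    show ?thesis
      using zero_product_form_third_difference[OF
          zero_product_form_shift[OF \<psi>', of "u ^ (n + 2)" "v ^ (n + 1)"] inv bdd]
      unfolding F_def p q mult_1_left mult_1_right .
  qed
  obtain C where C: "\<And>x y. norm (\<psi>' x y) \<le> norm x * norm y * C" "C > 0"
    using pos_bounded by blast
  have F_bdd: "norm (F n) \<le> K * K * C" for n
    unfolding F_def using C(2) bdd order.trans[OF norm_ge_zero bdd(1)]
    by (intro order.trans[OF C(1)] mult_right_mono mult_mono) auto
  define H where "H n = F (Suc n) - F n" for n
  have H_bdd: "norm (H n) \<le> K * K * C + K * K * C" for n
    unfolding H_def by (rule order.trans[OF norm_triangle_ineq4 add_mono[OF F_bdd F_bdd]])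
  have three: "3 *\<^sub>R a = a + a + a" for a :: 'b
    using scaleR_left_distrib[of 2 1 a] by (simp add: scaleR_2)
  have second_const: "H (Suc n) - H n = H 1 - H 0" for n
  proof (induction n)
    case (Suc n)
    have "F n + 3 *\<^sub>R F (Suc (Suc n)) = F (Suc (Suc (Suc n))) + 3 *\<^sub>R F (Suc n)"
      using third[of n] by (simp add: numeral_2_eq_2 numeral_3_eq_3)
    hence "H (Suc (Suc n)) - H (Suc n) = H (Suc n) - H n"
      unfolding H_def three by (simp add: algebra_simps)
    thus ?case using Suc by simp
  qed simp
  hence H_step: "H (Suc n) = H n + (H 1 - H 0)" for n
    by (metis add.commute diff_add_cancel)
  have second_zero: "H 1 - H 0 = 0"
    by (rule bounded_arithmetic_progression_constant[where F = H, OF H_step H_bdd])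
  have H_const: "H n = H 0" for n
  proof (induction n)
    case (Suc n)
    thus ?case by (simp only: H_step[of n] second_zero add_0_right)
  qed simp
  have F_step: "F (Suc n) = F n + H 0" for n
    using H_const[of n] by (simp add: H_def algebra_simps)
  have "H 0 = 0"
    by (rule bounded_arithmetic_progression_constant[where F = F, OF F_step F_bdd])
  hence "\<psi> u (v * u) = \<psi> 1 u"
    by (simp add: H_def F_def \<psi>'_def)
  thus ?thesis using inv by simp
qed

section \<open>The unitization of an algebra\<close>

text \<open>The algebra with a unit adjoined, with the norm \<open>\<bar>l\<bar> + norm a\<close> of \<open>l + a\<close>. This is a complete
  algebra norm whether or not the algebra already has a unit. The C*-identity
  fails for it in general, but the norms of isometries are bounded by a constant, so unitaries are
  still power bounded.\<close>

datatype 'a unitization = Unitization (scalar_part: complex) (algebra_part: 'a)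

lemma unitization_eq_iff:
  "x = y \<longleftrightarrow> scalar_part x = scalar_part y \<and> algebra_part x = algebra_part y"
  by (auto intro: unitization.expand)

instantiation unitization :: (complex_normed_algebra) complex_normed_algebra
begin

definition "(0 :: 'a unitization) = Unitization 0 0"
definition "x + y = Unitization (scalar_part x + scalar_part y) (algebra_part x + algebra_part y)"
  for x y :: "'a unitization"
definition "x - y = Unitization (scalar_part x - scalar_part y) (algebra_part x - algebra_part y)"
  for x y :: "'a unitization"
definition "- x = Unitization (- scalar_part x) (- algebra_part x)"
  for x :: "'a unitization"
definition "x * y = Unitization (scalar_part x * scalar_part y)
  (scalar_part x *\<^sub>C algebra_part y + scalar_part y *\<^sub>C algebra_part x + algebra_part x * algebra_part y)"
  for x y :: "'a unitization"
definition "r *\<^sub>R x = Unitization (r *\<^sub>R scalar_part x) (r *\<^sub>R algebra_part x)"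
  for x :: "'a unitization"
definition "c *\<^sub>C x = Unitization (c * scalar_part x) (c *\<^sub>C algebra_part x)"
  for x :: "'a unitization"
definition "norm x = cmod (scalar_part x) + norm (algebra_part x)"
  for x :: "'a unitization"
definition "dist x y = norm (x - y)"
  for x y :: "'a unitization"
definition "sgn x = inverse (norm x) *\<^sub>R x"
  for x :: "'a unitization"
definition "uniformity = (INF e\<in>{0<..}. principal {(x, y :: 'a unitization). dist x y < e})"
definition "open U = (\<forall>x\<in>U. eventually (\<lambda>(x', y). x' = x \<longrightarrow> y \<in> U) uniformity)"
  for U :: "'a unitization set"

lemma unitization_parts [simp]:
  "scalar_part 0 = 0" "algebra_part (0 :: 'a unitization) = 0"
  "scalar_part (x + y) = scalar_part x + scalar_part y"
  "algebra_part (x + y) = algebra_part x + algebra_part y"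
  "scalar_part (x - y) = scalar_part x - scalar_part y"
  "algebra_part (x - y) = algebra_part x - algebra_part y"
  "scalar_part (- x) = - scalar_part x"
  "algebra_part (- x) = - algebra_part x"
  "scalar_part (x * y) = scalar_part x * scalar_part y"
  "algebra_part (x * y) = scalar_part x *\<^sub>C algebra_part y + scalar_part y *\<^sub>C algebra_part x
     + algebra_part x * algebra_part y"
  "scalar_part (r *\<^sub>R x) = r *\<^sub>R scalar_part x"
  "algebra_part (r *\<^sub>R x) = r *\<^sub>R algebra_part x"
  "scalar_part (c *\<^sub>C x) = c * scalar_part x"
  "algebra_part (c *\<^sub>C x) = c *\<^sub>C algebra_part x"
  for x y :: "'a unitization"
  by (simp_all add: zero_unitization_def plus_unitization_def minus_unitization_def
      uminus_unitization_def times_unitization_def scaleR_unitization_def scaleC_unitization_def)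

instance
proof
  fix x y z :: "'a unitization" and r s :: real and c d :: complex
  show "x * y * z = x * (y * z)"
    by (simp add: unitization_eq_iff algebra_simps scaleC_add_right scaleC_mult_left
        scaleC_mult_right scaleC_scaleC)
  show "norm (x * y) \<le> norm x * norm y"
  proof -
    have "norm (algebra_part (x * y)) \<le> cmod (scalar_part x) * norm (algebra_part y)
        + cmod (scalar_part y) * norm (algebra_part x) + norm (algebra_part x) * norm (algebra_part y)"
      unfolding unitization_parts norm_scaleC[symmetric]
      by (intro order.trans[OF norm_triangle_ineq] add_mono norm_mult_ineq) auto
    thus ?thesis by (simp add: norm_unitization_def norm_mult algebra_simps)
  qed
  show "norm (x + y) \<le> norm x + norm y"
    using norm_triangle_ineq[of "scalar_part x" "scalar_part y"]
      norm_triangle_ineq[of "algebra_part x" "algebra_part y"]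
    by (simp add: norm_unitization_def)
  show "r *\<^sub>R x * y = r *\<^sub>R (x * y)" "x * r *\<^sub>R y = r *\<^sub>R (x * y)"
    by (simp_all add: unitization_eq_iff scaleC_complex_def scaleC_add_right scaleC_mult_left
        scaleC_mult_right scaleC_scaleC mult_ac flip: scaleC_of_real)
  show "norm x = 0 \<longleftrightarrow> x = 0"
    by (simp add: norm_unitization_def unitization_eq_iff add_nonneg_eq_0_iff)
qed (simp_all add: unitization_eq_iff norm_unitization_def dist_unitization_def sgn_unitization_def
      uniformity_unitization_def open_unitization_def algebra_simps scaleC_add_right scaleC_add_left
      scaleC_mult_left scaleC_mult_right scaleC_scaleC scaleC_one scaleC_of_real scaleR_conv_of_real
      norm_scaleC norm_mult)

end

instantiation unitization :: (complex_normed_algebra) real_normed_algebra_1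
begin

definition "1 = Unitization 1 0"

lemma unitization_one_parts [simp]: "scalar_part 1 = 1" "algebra_part (1 :: 'a unitization) = 0"
  by (simp_all add: one_unitization_def)

instance
  by standard (simp_all add: unitization_eq_iff norm_unitization_def scaleC_one)

end

lemma bounded_linear_scalar_part: "bounded_linear (scalar_part :: 'a::complex_normed_algebra unitization \<Rightarrow> _)"
  by (rule bounded_linear_intro[where K = 1]) (auto simp: norm_unitization_def)

lemma bounded_linear_algebra_part: "bounded_linear (algebra_part :: 'a::complex_normed_algebra unitization \<Rightarrow> _)"
  by (rule bounded_linear_intro[where K = 1]) (auto simp: norm_unitization_def)

instance unitization :: ("{complex_normed_algebra,banach}") banach
proof
  fix X :: "nat \<Rightarrow> 'a unitization"
  assume X: "Cauchy X"
  have "convergent (\<lambda>n. scalar_part (X n))"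
    by (rule Cauchy_convergent[OF bounded_linear.Cauchy[OF bounded_linear_scalar_part X]])
  moreover have "convergent (\<lambda>n. algebra_part (X n))"
    by (rule Cauchy_convergent[OF bounded_linear.Cauchy[OF bounded_linear_algebra_part X]])
  ultimately obtain l a where l: "(\<lambda>n. scalar_part (X n)) \<longlonglongrightarrow> l"
    and a: "(\<lambda>n. algebra_part (X n)) \<longlonglongrightarrow> a"
    unfolding convergent_def by blast
  have "(\<lambda>n. norm (scalar_part (X n) - l) + norm (algebra_part (X n) - a)) \<longlonglongrightarrow> 0 + 0"
    using l a by (intro tendsto_add tendsto_norm_zero) (auto simp: LIM_zero_iff)
  hence "(\<lambda>n. norm (X n - Unitization l a)) \<longlonglongrightarrow> 0"
    by (simp add: norm_unitization_def)
  hence "X \<longlonglongrightarrow> Unitization l a"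
    by (rule LIM_zero_cancel[OF tendsto_norm_zero_cancel])
  thus "convergent X" by (rule convergentI)
qed

section \<open>Unitaries\<close>

lemma norm_star: "norm (star a) = norm (a :: 'a::cstar_algebra)"
proof -
  have le: "norm x \<le> norm (star x)" for x :: 'a
  proof (cases "x = 0")
    case False
    have "norm x * norm x \<le> norm (star x) * norm x"
      using norm_mult_ineq[of "star x" x] by (simp add: cstar_identity power2_eq_square)
    thus ?thesis using False by simp
  qed simp
  show ?thesis using le[of a] le[of "star a"] by (simp add: star_star)
qed

lemma star_scaleR: "star (r *\<^sub>R a) = r *\<^sub>R star (a :: 'a::cstar_algebra)"
  using star_scaleC[of "complex_of_real r" a] by (simp add: scaleC_of_real)

definition unitization_star :: "'a unitization \<Rightarrow> 'a::cstar_algebra unitization"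
  where "unitization_star x = Unitization (cnj (scalar_part x)) (star (algebra_part x))"

lemma unitization_star_parts [simp]:
  "scalar_part (unitization_star x) = cnj (scalar_part x)"
  "algebra_part (unitization_star x) = star (algebra_part x)"
  by (simp_all add: unitization_star_def)

lemma star_0 [simp]: "star (0 :: 'a::cstar_algebra) = 0"
  using star_scaleR[of 0 "0::'a"] by simp

lemma bounded_linear_unitization_star: "bounded_linear unitization_star"
  by (rule bounded_linear_intro[where K = 1])
    (simp_all add: unitization_eq_iff norm_unitization_def norm_star star_add star_scaleR)

lemma unitization_star_mult: "unitization_star (x * y) = unitization_star y * unitization_star x"
  by (simp add: unitization_eq_iff star_add star_scaleC star_mult)

lemma unitization_star_scaleC: "unitization_star (c *\<^sub>C x) = cnj c *\<^sub>C unitization_star x"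
  by (simp add: unitization_eq_iff star_scaleC)

lemma unitization_star_power: "unitization_star (x ^ n) = unitization_star x ^ n"
proof (induction n)
  case 0
  show ?case by (simp add: unitization_eq_iff)
next
  case (Suc n)
  thus ?case by (simp only: power_Suc unitization_star_mult power_commutes)
qed

text \<open>With \<open>v = l + k\<close>, the equation \<open>v* v = 1\<close> says \<open>\<bar>l\<bar> = 1\<close> and expresses \<open>k* k\<close> linearly in
  \<open>k\<close> and \<open>k*\<close>. The C*-identity then gives \<open>(norm k)^2 \<le> 2 * norm k\<close>.\<close>

lemma norm_isometry_le:
  assumes "unitization_star v * v = 1"
  shows "norm v \<le> 3"
proof -
  define l k where "l = scalar_part v" and "k = algebra_part v"
  have l: "cnj l * l = 1" and k: "cnj l *\<^sub>C k + l *\<^sub>C star k + star k * k = 0"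
    using arg_cong[OF assms, of scalar_part] arg_cong[OF assms, of algebra_part]
    by (simp_all add: l_def k_def)
  have "cmod l ^ 2 = cmod (cnj l * l)"
    by (simp add: norm_mult power2_eq_square)
  hence "cmod l ^ 2 = 1 ^ 2" using l by simp
  hence nl: "cmod l = 1" by (rule power2_eq_imp_eq) simp_all
  have "norm k ^ 2 = norm (star k * k)" by (simp add: cstar_identity)
  also have "star k * k = - (cnj l *\<^sub>C k + l *\<^sub>C star k)"
    by (rule minus_unique[OF k, symmetric])
  also have "norm \<dots> \<le> norm (cnj l *\<^sub>C k) + norm (l *\<^sub>C star k)"
    unfolding norm_minus_cancel by (rule norm_triangle_ineq)
  also have "\<dots> = 2 * norm k"
    by (simp add: norm_scaleC nl norm_star)
  finally have "norm k \<le> 2"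
    by (cases "k = 0") (simp_all add: power2_eq_square)
  thus ?thesis using nl by (simp add: norm_unitization_def l_def k_def)
qed

text \<open>The unitaries are \<open>sqrt (1 - a^2) \<plusminus> \<i> a\<close>.\<close>

lemma selfadjoint_as_difference_of_unitaries:
  fixes a :: "'a::cstar_algebra"
  assumes sa: "star a = a" and norm: "norm a \<le> 1"
  obtains u v :: "'a unitization" where "u * v = 1" "v * u = 1"
    "\<And>n. norm (u ^ n) \<le> 3" "\<And>n. norm (v ^ n) \<le> 3"
    "u - v = (2 * \<i>) *\<^sub>C Unitization 0 a"
proof -
  define A :: "'a unitization" where "A = Unitization 0 a"
  define w where "w = sqrt_series (A * A)"
  define u v where "u = w + \<i> *\<^sub>C A" and "v = w - \<i> *\<^sub>C A"
  have A_star: "unitization_star A = A"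
    using sa by (simp add: A_def unitization_star_def)
  have "norm A \<le> 1" using norm by (simp add: A_def norm_unitization_def)
  hence bdd: "norm ((A * A) ^ n) \<le> 1" for n
    by (intro order.trans[OF norm_power_ineq] power_le_one norm_ge_zero
        order.trans[OF norm_mult_ineq] mult_le_one)
  have ww: "w * w = 1 - A * A"
    unfolding w_def by (rule sqrt_series_squared[OF bdd])
  have comm: "A * w = w * A"
    unfolding w_def by (rule sqrt_series_commute[OF bdd]) (simp add: mult.assoc)
  have w_star: "unitization_star w = w"
    unfolding w_def sqrt_series_def
    using bounded_linear.suminf[OF bounded_linear_unitization_star
        summable_norm_cancel[OF summable_norm_sqrt_series[OF bdd]]]
    by (simp add: linear_scale[OF bounded_linear.linear[OF bounded_linear_unitization_star]]
        unitization_star_power unitization_star_mult A_star)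
  have star_uv: "unitization_star u = v" "unitization_star v = u"
    using linear_add[OF bounded_linear.linear[OF bounded_linear_unitization_star], of w "\<i> *\<^sub>C A"]
      linear_diff[OF bounded_linear.linear[OF bounded_linear_unitization_star], of w "\<i> *\<^sub>C A"]
    by (simp_all add: u_def v_def w_star A_star unitization_star_scaleC complex_vector.scale_minus_left)
  have uv: "u * v = 1" "v * u = 1"
    using ww comm by (simp_all add: u_def v_def algebra_simps scaleC_mult_left scaleC_mult_right
        scaleC_scaleC scaleC_one complex_vector.scale_minus_left)
  have "v ^ n * u ^ n = 1" "u ^ n * v ^ n = 1" for n
    using uv by (metis left_right_inverse_power)+
  hence "norm (u ^ n) \<le> 3" "norm (v ^ n) \<le> 3" for n
    by (simp_all add: norm_isometry_le unitization_star_power star_uv)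
  moreover have "u - v = (2 * \<i>) *\<^sub>C A"
    using scaleC_add_left[of \<i> \<i> A] by (simp add: u_def v_def)
  ultimately show thesis using that uv unfolding A_def by blast
qed

section \<open>Zero products in C*-algebras\<close>

lemma selfadjoint_decomposition:
  fixes a :: "'a::cstar_algebra"
  obtains h k where "star h = h" "star k = k" "a = h + \<i> *\<^sub>C k"
proof
  let ?h = "(1/2) *\<^sub>C (a + star a)" and ?k = "(- \<i>/2) *\<^sub>C (a - star a)"
  have diff: "star (x - y) = star x - star y" for x y :: 'a
    using star_add[of "x - y" y] by simp
  show "star ?h = ?h" by (simp add: star_scaleC star_add star_star add.commute)
  show "star ?k = ?k"
    by (simp add: star_scaleC diff star_star complex_vector.scale_right_diff_distrib
        complex_vector.scale_minus_left)
  have "\<i> *\<^sub>C ?k = (1/2) *\<^sub>C (a - star a)" by (simp add: scaleC_scaleC)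
  hence "?h + \<i> *\<^sub>C ?k = (1/2) *\<^sub>C ((a + star a) + (a - star a))"
    by (simp only: scaleC_add_right)
  also have "(a + star a) + (a - star a) = 2 *\<^sub>C a"
    using scaleC_add_left[of 1 1 a] by (simp add: scaleC_one)
  finally show "a = ?h + \<i> *\<^sub>C ?k" by (simp add: scaleC_scaleC scaleC_one)
qed

lemma selfadjoint_rescale:
  fixes a :: "'a::cstar_algebra"
  assumes "star a = a"
  obtains b r where "star b = b" "norm b \<le> 1" "a = r *\<^sub>R b"
proof (cases "a = 0")
  case True
  thus thesis using that[of 0 0] by simp
next
  case False
  thus thesis
    using assms by (intro that[of "inverse (norm a) *\<^sub>R a" "norm a"]) (simp_all add: star_scaleR)
qed

lemma scaleR_complex_scaleC: "(r *\<^sub>R z) *\<^sub>C x = r *\<^sub>R z *\<^sub>C x" for x :: "'a::complex_vector"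
  by (simp only: scaleR_conv_of_real scaleC_scaleC[symmetric] scaleC_of_real)

text \<open>The form \<open>(x, y) \<mapsto> \<phi> (b x) (y c)\<close> extends to the unitization and still vanishes on zero
  products, because the middle factors of \<open>(b x) (y c)\<close> multiply to zero. The result for unitaries
  passes to selfadjoint elements of norm at most 1, hence to all elements by linearity.\<close>

lemma zero_product_form_balanced:
  fixes \<phi> :: "'a::cstar_algebra \<Rightarrow> 'a \<Rightarrow> 'b::complex_normed_vector"
  assumes \<phi>: "zero_product_form \<phi>"
  shows "\<phi> (b * a) c = \<phi> b (a * c)"
proof -
  interpret bounded_bilinear \<phi> using \<phi> by (simp add: zero_product_form_def)
  have sc: "\<phi> (c *\<^sub>C x) y = c *\<^sub>C \<phi> x y" "\<phi> x (c *\<^sub>C y) = c *\<^sub>C \<phi> x y" for c x y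
    using \<phi> by (auto simp: zero_product_form_def)
  have unit_ball: "\<phi> (b * a) c = \<phi> b (a * c)" if a: "star a = a" "norm a \<le> 1" for a
  proof -
    obtain u v :: "'a unitization" where uv: "u * v = 1" "v * u = 1"
      and bdd: "\<And>n. norm (u ^ n) \<le> 3" "\<And>n. norm (v ^ n) \<le> 3"
      and diff_uv: "u - v = (2 * \<i>) *\<^sub>C Unitization 0 a"
      using selfadjoint_as_difference_of_unitaries[OF a] by blast
    define R where "R x = scalar_part x *\<^sub>C b + b * algebra_part x" for x :: "'a unitization"
    define L where "L y = scalar_part y *\<^sub>C c + algebra_part y * c" for y :: "'a unitization"
    define \<psi> where "\<psi> x y = \<phi> (R x) (L y)" for x y
    have bdd_lin: "bounded_linear R" "bounded_linear L"
    proof -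
      have sc_lin: "bounded_linear (\<lambda>x :: 'a unitization. scalar_part x *\<^sub>C d)" for d :: 'a
        by (rule bounded_linear_intro[where K = "norm d"])
          (auto simp: scaleC_add_left scaleR_complex_scaleC norm_scaleC norm_unitization_def mult_right_mono)
      show "bounded_linear R"
        unfolding R_def[abs_def]
        by (rule bounded_linear_add[OF sc_lin bounded_linear_const_mult[OF bounded_linear_algebra_part]])
      show "bounded_linear L"
        unfolding L_def[abs_def]
        by (rule bounded_linear_add[OF sc_lin bounded_linear_mult_const[OF bounded_linear_algebra_part]])
    qed
    have "zero_product_form \<psi>"
      unfolding \<psi>_def[abs_def]
    proof (rule zero_product_form_comp[OF \<phi> bdd_lin(1) _ bdd_lin(2)])
      fix x y :: "'a unitization" assume xy: "x * y = 0"
      have "R x * L y = scalar_part (x * y) *\<^sub>C (b * c) + b * algebra_part (x * y) * c"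
        by (simp add: R_def L_def algebra_simps scaleC_mult_left scaleC_mult_right scaleC_scaleC)
      thus "R x * L y = 0" by (simp add: xy)
    qed (simp_all add: R_def L_def scaleC_add_right scaleC_scaleC scaleC_mult_left scaleC_mult_right)
    hence "\<psi> u 1 = \<psi> 1 u" "\<psi> v 1 = \<psi> 1 v"
      by (rule zero_product_form_doubly_power_bounded[OF _ uv bdd],
          rule zero_product_form_doubly_power_bounded[OF _ uv(2,1) bdd(2,1)])
    moreover have "\<psi> (u - v) 1 = \<psi> u 1 - \<psi> v 1" "\<psi> 1 (u - v) = \<psi> 1 u - \<psi> 1 v"
      using bdd_lin by (simp_all add: \<psi>_def linear_diff[OF bounded_linear.linear] diff_left diff_right)
    ultimately have "\<psi> (u - v) 1 = \<psi> 1 (u - v)" by simp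
    hence "(2 * \<i>) *\<^sub>C \<phi> (b * a) c = (2 * \<i>) *\<^sub>C \<phi> b (a * c)"
      by (simp add: \<psi>_def R_def L_def diff_uv scaleC_one scaleC_mult_left scaleC_mult_right sc)
    thus ?thesis by simp
  qed
  have selfadjoint: "\<phi> (b * a) c = \<phi> b (a * c)" if sa: "star a = a" for a
  proof -
    obtain a' r where a': "star a' = a'" "norm a' \<le> 1" "a = r *\<^sub>R a'"
      by (rule selfadjoint_rescale[OF sa])
    show ?thesis
      unfolding a'(3) using unit_ball[OF a'(1,2)] by (simp add: scaleR_left scaleR_right)
  qed
  obtain h k where hk: "star h = h" "star k = k" "a = h + \<i> *\<^sub>C k"
    by (rule selfadjoint_decomposition[of a])
  show ?thesis
    unfolding hk(3) distrib_left distrib_right scaleC_mult_left scaleC_mult_right add_left add_right sc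
    by (simp only: selfadjoint[OF hk(1)] selfadjoint[OF hk(2)])
qed

section \<open>Commuting approximate units\<close>

text \<open>Write \<open>c\<close> as a multiple of \<open>u - v\<close> with \<open>v\<close> the inverse of \<open>u\<close>. The product of \<open>u - v\<close> with the
  Cesaro mean of \<open>u^0, u^2, ..., u^(2n)\<close> telescopes and therefore tends to 0. One minus this mean
  has scalar part 0, so it lies in the algebra itself.\<close>

lemma selfadjoint_approximate_unit:
  fixes c :: "'a::cstar_algebra"
  assumes c: "star c = c" "norm c \<le> 1"
  obtains e where "\<And>n. e n * c = c * e n" "(\<lambda>n. c * e n) \<longlonglongrightarrow> c"
proof -
  obtain u v :: "'a unitization" where uv: "u * v = 1" "v * u = 1"
    and bdd: "\<And>n. norm (u ^ n) \<le> 3" "\<And>n. norm (v ^ n) \<le> 3"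
    and diff_uv: "u - v = (2 * \<i>) *\<^sub>C Unitization 0 c"
    using selfadjoint_as_difference_of_unitaries[OF c] by blast
  define C where "C = Unitization 0 c"
  define x where "x = u * u"
  define g where "g n = 1 - (1 / real (Suc n)) *\<^sub>R (\<Sum>j<Suc n. x ^ j)" for n
  define e where "e n = algebra_part (g n)" for n
  have C: "C = (1 / (2 * \<i>)) *\<^sub>C (u - v)"
    by (simp add: diff_uv C_def scaleC_scaleC scaleC_one)
  have "scalar_part u = scalar_part v"
    using arg_cong[OF diff_uv, of scalar_part] by simp
  hence "scalar_part x = 1"
    using arg_cong[OF uv(1), of scalar_part] by (simp add: x_def)
  hence "scalar_part (x ^ j) = 1" for j
    by (induction j) simp_all
  hence "scalar_part (g n) = 0" for n
    using linear_sum[OF bounded_linear.linear[OF bounded_linear_scalar_part], of "\<lambda>j. x ^ j"]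
    by (simp add: g_def del: sum.lessThan_Suc of_nat_Suc)
      (simp add: scaleR_conv_of_real del: of_nat_Suc)
  hence g: "g n = Unitization 0 (e n)" for n
    by (simp add: e_def unitization_eq_iff)
  have "v * x = u" "x * v = u"
    using uv unfolding x_def by (metis mult.assoc mult_1_left mult_1_right)+
  hence "C * x = x * C"
    by (simp add: C scaleC_mult_left scaleC_mult_right algebra_simps) (simp add: x_def mult.assoc)
  hence "C * x ^ j = x ^ j * C" for j
    by (metis power_commuting_commutes)
  hence "g n * C = C * g n" for n
    by (simp add: g_def algebra_simps sum_distrib_left sum_distrib_right del: sum.lessThan_Suc)
  hence "e n * c = c * e n" for n
    by (simp add: g C_def unitization_eq_iff)
  moreover have "(\<lambda>n. c * e n) \<longlonglongrightarrow> c"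
  proof -
    have bound: "norm (c * e n - c) \<le> 6 / real (Suc n)" for n
    proof -
      have tele: "(u - v) * (\<Sum>j<m. x ^ j) = v * (x ^ m - 1)" for m
      proof (induction m)
        case (Suc m)
        have "(u - v) * x ^ m = v * (x ^ Suc m - x ^ m)"
          using \<open>v * x = u\<close> by (simp add: algebra_simps flip: mult.assoc)
        thus ?case using Suc by (simp add: algebra_simps)
      qed simp
      have "C - C * g n = (1 / real (Suc n)) *\<^sub>R (C * (\<Sum>j<Suc n. x ^ j))"
        by (simp add: g_def algebra_simps del: sum.lessThan_Suc)
      also have "\<dots> = (1 / real (Suc n)) *\<^sub>R (1 / (2 * \<i>)) *\<^sub>C (v * (x ^ Suc n - 1))"
        unfolding C scaleC_mult_left tele ..
      finally have "norm (C - C * g n) = (1 / real (Suc n)) * (norm (v * (x ^ Suc n - 1)) / 2)"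
        by (simp add: norm_scaleC norm_mult norm_divide del: of_nat_Suc)
      also have "\<dots> \<le> (1 / real (Suc n)) * 6"
      proof (rule mult_left_mono)
        have "norm (x ^ Suc n) \<le> 3"
          using bdd(1)[of "2 * Suc n"] by (simp only: x_def power_mult power2_eq_square)
        hence "norm (x ^ Suc n - 1) \<le> 3 + 1"
          by (intro order.trans[OF norm_triangle_ineq4] add_mono) auto
        hence "norm (v * (x ^ Suc n - 1)) \<le> 3 * (3 + 1)"
          using bdd(2)[of 1] by (intro order.trans[OF norm_mult_ineq] mult_mono) auto
        thus "norm (v * (x ^ Suc n - 1)) / 2 \<le> 6" by simp
      qed simp
      finally show ?thesis
        by (simp add: norm_unitization_def C_def g norm_minus_commute)
    qed
    have "(\<lambda>n. 6 / real (Suc n)) \<longlonglongrightarrow> 0"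
      using tendsto_mult_right_zero[OF LIMSEQ_inverse_real_of_nat, of 6] by (simp add: divide_inverse)
    hence "(\<lambda>n. c * e n - c) \<longlonglongrightarrow> 0"
      by (rule tendsto_0_le[where K = 1]) (simp add: bound del: of_nat_Suc)
    thus ?thesis by (rule LIM_zero_cancel)
  qed
  ultimately show thesis by (rule that)
qed

section \<open>From Jordan homomorphisms to homomorphisms\<close>

text \<open>Apply the Jordan identity to \<open>x d\<close> and \<open>d\<close>. Balancedness turns \<open>T (x d) T d\<close> into
  \<open>T x T (d^2)\<close>, and \<open>T d T (x d)\<close> into \<open>T (d x) T d\<close>, which a second use of the Jordan identity
  identifies with the triple product \<open>T (d x d)\<close>.\<close>

lemma balanced_jordan_hom_mult_square:
  fixes T :: "'a::real_algebra \<Rightarrow> 'b::real_algebra"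
  assumes T: "linear T"
    and square: "\<And>x. T (x * x) = T x * T x"
    and balanced: "\<And>x y z. T (x * y) * T z = T x * T (y * z)"
  shows "T (x * (d * d)) = T x * T (d * d)"
proof -
  note add = linear_add[OF T]
  have jordan: "T (y * z) + T (z * y) = T y * T z + T z * T y" for y z
    using square[of "y + z"] by (simp add: add distrib_left distrib_right square algebra_simps)
  have triple: "T (d * x * d) = T d * T x * T d"
  proof -
    have "2 *\<^sub>R T (d * x * d)
        = (T (d * (d * x + x * d)) + T ((d * x + x * d) * d)) - (T (d * d * x) + T (x * (d * d)))"
      by (simp add: add algebra_simps scaleR_2)
    also have "\<dots> = (T d * (T d * T x + T x * T d) + (T d * T x + T x * T d) * T d)
        - (T d * T d * T x + T x * (T d * T d))"
      using jordan[of d "d * x + x * d"] jordan[of d x] jordan[of "d * d" x]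
      by (simp only: add square)
    also have "\<dots> = 2 *\<^sub>R (T d * T x * T d)"
      by (simp add: algebra_simps scaleR_2)
    finally have "2 *\<^sub>R T (d * x * d) = 2 *\<^sub>R (T d * T x * T d)" .
    thus ?thesis by simp
  qed
  have "T d * T (x * d) = T (d * x) * T d"
    by (simp only: balanced)
  also have "T (d * x) = T d * T x + T x * T d - T (x * d)"
    using jordan[of d x] by (simp add: algebra_simps)
  also have "\<dots> * T d = T (d * x * d)"
    using triple by (simp add: balanced square algebra_simps)
  finally have "T d * T (x * d) = T (d * x * d)" .
  thus ?thesis
    using jordan[of "x * d" d] balanced[of x d d] by (simp add: mult.assoc)
qed

lemma clinear_simps:
  assumes "clinear T"
  shows "T (x + y) = T x + T y" "T (c *\<^sub>C x) = c *\<^sub>C T x" "T (x - y) = T x - T y"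
    "T (r *\<^sub>R x) = r *\<^sub>R T x"
proof -
  show add: "T (x + y) = T x + T y" for x y using assms by (simp add: clinear_iff)
  show sc: "T (c *\<^sub>C x) = c *\<^sub>C T x" for c x using assms by (simp add: clinear_iff)
  show "T (x - y) = T x - T y" using add[of "x - y" y] by simp
  show "T (r *\<^sub>R x) = r *\<^sub>R T x" using sc[of "complex_of_real r" x] by (simp add: scaleC_of_real)
qed

lemma bounded_clinear_imp_bounded_linear:
  assumes "bounded_clinear T"
  shows "bounded_linear T"
proof -
  obtain K where "clinear T" "\<And>x. norm (T x) \<le> K * norm x"
    using assms by (auto simp: bounded_clinear_def)
  thus ?thesis
    by (intro bounded_linear_intro[where K = K]) (simp_all add: clinear_simps mult.commute)
qed

text \<open>Squares polarize to products of commuting elements, and by the approximate unit every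
  selfadjoint element is a limit of such products.\<close>

lemma jordan_hom_preserving_zero_products:
  fixes T :: "'a::cstar_algebra \<Rightarrow> 'b::complex_normed_algebra"
  assumes T: "bounded_clinear T"
    and square: "\<And>x. T (x * x) = T x * T x"
    and zero: "\<And>x y. x * y = 0 \<Longrightarrow> T x * T y = 0"
  shows "T (x * y) = T x * T y"
proof -
  have bl: "bounded_linear T" by (rule bounded_clinear_imp_bounded_linear[OF T])
  have cl: "clinear T" using T by (simp add: bounded_clinear_def)
  note lin = clinear_simps[OF cl]
  have "zero_product_form (\<lambda>x y. T x * T y)"
    using bounded_bilinear.comp[OF bounded_bilinear_mult bl bl] zero
    by (simp add: zero_product_form_def lin scaleC_mult_left scaleC_mult_right)
  hence balanced: "T (x * y) * T z = T x * T (y * z)" for x y z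
    by (rule zero_product_form_balanced)
  have mult_square: "T (x * (d * d)) = T x * T (d * d)" for d
    by (rule balanced_jordan_hom_mult_square[OF bounded_linear.linear[OF bl] square balanced])
  have mult_commuting: "T (x * (d * e)) = T x * T (d * e)" if "e * d = d * e" for d e
  proof -
    have "(d + e) * (d + e) - (d - e) * (d - e) = 4 *\<^sub>R (d * e)"
      using that scaleR_left_distrib[of 2 2 "d * e"] by (simp add: algebra_simps scaleR_2)
    hence de: "d * e = (1/4) *\<^sub>R ((d + e) * (d + e) - (d - e) * (d - e))"
      by simp
    show ?thesis
      unfolding de by (simp only: mult_scaleR_right right_diff_distrib[of x] right_diff_distrib[of "T x"] lin mult_square)
  qed
  have unit_ball: "T (x * c) = T x * T c" if c: "star c = c" "norm c \<le> 1" for c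
  proof -
    obtain e where comm: "\<And>n. e n * c = c * e n" and lim: "(\<lambda>n. c * e n) \<longlonglongrightarrow> c"
      using selfadjoint_approximate_unit[OF c] by blast
    have "(\<lambda>n. T (x * (c * e n))) \<longlonglongrightarrow> T (x * c)"
      by (intro bounded_linear.tendsto[OF bl] tendsto_mult tendsto_const lim)
    moreover have "(\<lambda>n. T x * T (c * e n)) \<longlonglongrightarrow> T x * T c"
      by (intro bounded_linear.tendsto[OF bl] tendsto_mult tendsto_const lim)
    ultimately show ?thesis
      using LIMSEQ_unique by (simp add: mult_commuting[OF comm])
  qed
  have selfadjoint: "T (x * c) = T x * T c" if sa: "star c = c" for c
  proof -
    obtain c' r where c': "star c' = c'" "norm c' \<le> 1" "c = r *\<^sub>R c'"
      by (rule selfadjoint_rescale[OF sa])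
    show ?thesis
      unfolding c'(3) using unit_ball[OF c'(1,2)] by (simp add: lin)
  qed
  obtain h k where hk: "star h = h" "star k = k" "y = h + \<i> *\<^sub>C k"
    by (rule selfadjoint_decomposition[of y])
  show ?thesis
    unfolding hk(3) distrib_left scaleC_mult_right lin
    by (simp only: selfadjoint[OF hk(1)] selfadjoint[OF hk(2)])
qed

section \<open>Linear 2-local homomorphisms\<close>

text \<open>The pair \<open>x\<close>, \<open>x * x\<close> shows that \<open>T\<close> preserves squares; a pair with product zero shows that
  it preserves zero products.\<close>

lemma two_local_hom_imp_algebra_hom:
  assumes T: "bounded_clinear T" and loc: "two_local_hom T"
  shows "algebra_hom T"
proof -
  have \<Phi>: "\<exists>\<Phi>. algebra_hom \<Phi> \<and> \<Phi> a = T a \<and> \<Phi> b = T b" for a b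
    using loc by (auto simp: two_local_hom_def)
  have "T (x * x) = T x * T x" for x
    using \<Phi>[of x "x * x"] by (metis algebra_hom_def)
  moreover have "T x * T y = 0" if "x * y = 0" for x y
  proof -
    obtain \<Phi> where "algebra_hom \<Phi>" "\<Phi> x = T x" "\<Phi> y = T y" using \<Phi> by blast
    hence "T x * T y = \<Phi> (0 *\<^sub>C 0)" using that by (metis algebra_hom_def complex_vector.scale_zero_right)
    also have "\<dots> = 0" using \<open>algebra_hom \<Phi>\<close> by (simp only: algebra_hom_def clinear_simps) simp
    finally show ?thesis .
  qed
  ultimately show ?thesis
    using jordan_hom_preserving_zero_products[OF T] T
    by (auto simp: algebra_hom_def bounded_clinear_def)
qed

text \<open>For selfadjoint \<open>x\<close>, \<open>y\<close> the single element \<open>x + \<i> y\<close> determines both of them through the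
  involution, so 2-locality at \<open>x + \<i> y\<close> and \<open>x * y\<close> acts like 3-locality at \<open>x\<close>, \<open>y\<close>, \<open>x * y\<close>.\<close>

lemma two_local_star_hom_imp_star_hom:
  assumes T: "clinear T" and loc: "two_local_star_hom T"
  shows "star_hom T"
proof -
  note lin = clinear_simps[OF T]
  have star: "T (star x) = star (T x)" for x
  proof -
    obtain \<Phi> where "star_hom \<Phi>" "\<Phi> x = T x" "\<Phi> (star x) = T (star x)"
      using loc unfolding two_local_star_hom_def by blast
    thus ?thesis by (simp add: star_hom_def)
  qed
  have selfadjoint: "T (x * y) = T x * T y" if "star x = x" "star y = y" for x y
  proof -
    obtain \<Phi> where \<Phi>: "star_hom \<Phi>" "\<Phi> (x + \<i> *\<^sub>C y) = T (x + \<i> *\<^sub>C y)" "\<Phi> (x * y) = T (x * y)"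
      using loc unfolding two_local_star_hom_def by blast
    have hom: "clinear \<Phi>" "\<Phi> (a * b) = \<Phi> a * \<Phi> b" "\<Phi> (star a) = star (\<Phi> a)" for a b
      using \<Phi>(1) by (auto simp: star_hom_def algebra_hom_def)
    note \<Phi>_lin = clinear_simps[OF hom(1)]
    have plus: "\<Phi> x + \<i> *\<^sub>C \<Phi> y = T x + \<i> *\<^sub>C T y"
      using \<Phi>(2) by (simp only: lin \<Phi>_lin)
    have "star (\<Phi> x + \<i> *\<^sub>C \<Phi> y) = star (T x + \<i> *\<^sub>C T y)" by (simp only: plus)
    hence "\<Phi> x - \<i> *\<^sub>C \<Phi> y = T x - \<i> *\<^sub>C T y"
      using star[of x] star[of y] hom(3)[of x] hom(3)[of y] that
      by (simp add: star_add star_scaleC complex_vector.scale_minus_left)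
    hence minus: "\<Phi> x - \<i> *\<^sub>C \<Phi> y = T x - \<i> *\<^sub>C T y" .
    have sum_diff: "2 *\<^sub>R p = (p + q) + (p - q)" "2 *\<^sub>R q = (p + q) - (p - q)" for p q :: 'b
      by (simp_all add: scaleR_2)
    have "2 *\<^sub>R \<Phi> x = 2 *\<^sub>R T x"
      unfolding sum_diff(1)[of "\<Phi> x" "\<i> *\<^sub>C \<Phi> y"] sum_diff(1)[of "T x" "\<i> *\<^sub>C T y"] plus minus ..
    moreover have "2 *\<^sub>R (\<i> *\<^sub>C \<Phi> y) = 2 *\<^sub>R (\<i> *\<^sub>C T y)"
      unfolding sum_diff(2)[of "\<i> *\<^sub>C \<Phi> y" "\<Phi> x"] sum_diff(2)[of "\<i> *\<^sub>C T y" "T x"] plus minus ..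
    ultimately have "\<Phi> x = T x" "\<Phi> y = T y" by simp_all
    thus ?thesis using \<Phi>(3) hom(2)[of x y] by simp
  qed
  have "T (x * y) = T x * T y" for x y
  proof -
    obtain h k where hk: "star h = h" "star k = k" "x = h + \<i> *\<^sub>C k"
      by (rule selfadjoint_decomposition[of x])
    obtain h' k' where hk': "star h' = h'" "star k' = k'" "y = h' + \<i> *\<^sub>C k'"
      by (rule selfadjoint_decomposition[of y])
    show ?thesis
      unfolding hk(3) hk'(3) distrib_left distrib_right scaleC_mult_left scaleC_mult_right lin
      by (simp only: selfadjoint hk(1,2) hk'(1,2))
  qed
  thus ?thesis using T star by (simp add: star_hom_def algebra_hom_def)
qed

theorem theorem3p9:
  shows "(\<forall>T :: 'a::cstar_algebra \<Rightarrow> 'b::cstar_algebra.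
            bounded_clinear T \<and> two_local_hom T \<longrightarrow> algebra_hom T) \<and>
         (\<forall>T :: 'a::cstar_algebra \<Rightarrow> 'b::cstar_algebra.
            clinear T \<and> two_local_star_hom T \<longrightarrow> star_hom T)"
proof (intro conjI allI impI)
  fix T :: "'a \<Rightarrow> 'b"
  show "algebra_hom T" if "bounded_clinear T \<and> two_local_hom T"
    using that by (simp add: two_local_hom_imp_algebra_hom)
  show "star_hom T" if "clinear T \<and> two_local_star_hom T"
    using that by (simp add: two_local_star_hom_imp_star_hom)
qed

end
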